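(* Let $\{\pi_k(t)\}_{k=0}^{\infty}$ be the monic Legendre polynomials, i.e. the monic polynomials with $\deg\pi_k=k$ that are mutually orthogonal with respect to $\langle f,g\rangle=\int_{-1}^{1}f(t)g(t)\,dt$, and let $\tilde\pi_k(t)=\pi_k(t)/\Vert\pi_k\Vert$ be the orthonormal Legendre polynomials. Then the $\tilde\pi_k$ satisfy the three-term recurrence relation \[ \tilde\pi_{k+1}(t)=\sqrt{4-\frac{1}{(k+1)^2}}\left(t\,\tilde\pi_k(t)-\frac{1}{\sqrt{4-\frac{1}{k^2}}}\,\tilde\pi_{k-1}(t)\right),\qquad k=1,2,\ldots, \] with initial conditions $\tilde\pi_0(t)=1/\Vert\pi_0\Vert=1/\sqrt2$ and $\tilde\pi_1(t)=t/\Vert\pi_1\Vert=\sqrt{\tfrac32}\,t$.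
   Context: A polynomial of degree $k$ is monic if its coefficient of $t^k$ equals $1$. The norm is $\Vert f\Vert=\langle f,f\rangle^{1/2}$. *)

theory Defs
  imports
    "HOL-Analysis.Analysis"
    "HOL-Computational_Algebra.Polynomial"
begin

definition L2_inner :: "real poly \<Rightarrow> real poly \<Rightarrow> real" where
  "L2_inner f g = integral {-1..1} (\<lambda>t. poly f t * poly g t)"

definition L2_poly_norm :: "real poly \<Rightarrow> real" where
  "L2_poly_norm f = sqrt (L2_inner f f)"

text \<open>The conditions below determine the sequence uniquely, so quantifying over all sequences
  that satisfy the predicate is the same as speaking of the monic Legendre polynomials.\<close>

definition monic_legendre :: "(nat \<Rightarrow> real poly) \<Rightarrow> bool" where
  "monic_legendre p \<longleftrightarrow>
     (\<forall>k. degree (p k) = k \<and> coeff (p k) k = 1) \<and>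
     (\<forall>j k. j \<noteq> k \<longrightarrow> L2_inner (p j) (p k) = 0)"

definition normalized_poly :: "real poly \<Rightarrow> real poly" where
  "normalized_poly f = smult (1 / L2_poly_norm f) f"

end

(* By orthogonality and parity, t p k - p (k+1) is a multiple of p (k-1), with factor
   h k / h (k-1), where h k is the squared norm of the monic polynomial p k. This ratio comes
   from two integrations by parts. Since t (p k)' is k (p k) plus terms of lower degree,
   integrating (t (p k)^2)' gives (2k+1) h k = p k (1)^2 + p k (-1)^2; integrating
   (p k p (k-1))' gives k h (k-1) = p k (1) p (k-1)(1) - p k (-1) p (k-1)(-1). By parity
   p k (-1) = (-1)^k p k (1), and squaring the second identity yields
   k^2 h (k-1) = (4k^2-1) h k. *)
theory Submission
  imports Defs
begin

section \<open>The inner product on real polynomials\<close>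

lemma L2_inner_integrable: "(\<lambda>t. poly f t * poly g t) integrable_on {-1..1::real}"
  by (intro integrable_continuous_real continuous_intros)

lemma L2_inner_commute: "L2_inner f g = L2_inner g f"
  by (simp add: L2_inner_def mult.commute)

lemma L2_inner_add_left: "L2_inner (f + g) h = L2_inner f h + L2_inner g h"
  unfolding L2_inner_def
  by (simp add: distrib_right integral_add L2_inner_integrable)

lemma L2_inner_smult_left: "L2_inner (smult c f) h = c * L2_inner f h"
  by (simp add: L2_inner_def mult.assoc)

lemma L2_inner_smult_right: "L2_inner f (smult c h) = c * L2_inner f h"
  by (metis L2_inner_commute L2_inner_smult_left)

lemma L2_inner_diff_left: "L2_inner (f - g) h = L2_inner f h - L2_inner g h"
  using L2_inner_add_left[of f "smult (-1) g" h] L2_inner_smult_left[of "-1" g h] by simp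

lemma L2_inner_nonneg: "L2_inner f f \<ge> 0"
  unfolding L2_inner_def by (rule integral_nonneg[OF L2_inner_integrable]) simp

text \<open>A continuous nonnegative integrand with integral zero vanishes on the interval, which
  gives \<open>f\<close> infinitely many roots.\<close>

lemma L2_inner_self_eq_0D:
  assumes "L2_inner f f = 0"
  shows "f = 0"
proof -
  have "continuous_on {-1..1} (\<lambda>t. poly f t * poly f t)"
    by (intro continuous_intros)
  then have "\<forall>t \<in> {-1..1}. poly f t * poly f t = 0"
    using assms unfolding L2_inner_def by (subst (asm) integral_eq_0_iff) simp_all
  then have "{-1..1} \<subseteq> {t. poly f t = 0}" by auto
  then have "infinite {t. poly f t = 0}"
    by (rule infinite_super) (simp add: infinite_Icc)
  then show ?thesis using poly_roots_finite by blast
qed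

lemma L2_inner_reflect:
  "L2_inner (pcompose f [:0, -1:]) (pcompose g [:0, -1:]) = L2_inner f g"
  using Henstock_Kurzweil_Integration.integral_reflect_real[of 1 "-1" "\<lambda>t. poly f t * poly g t"]
  by (simp add: L2_inner_def poly_pcompose)

text \<open>The fundamental theorem of calculus for \<open>f * g\<close>; this is how endpoint
  values enter.\<close>

lemma L2_inner_by_parts:
  "L2_inner (pderiv f) g + L2_inner f (pderiv g) = poly (f * g) 1 - poly (f * g) (-1)"
proof -
  have "((\<lambda>t. poly (pderiv (f * g)) t) has_integral poly (f * g) 1 - poly (f * g) (-1)) {-1..1}"
    by (intro fundamental_theorem_of_calculus)
      (simp_all only: flip: has_real_derivative_iff_has_vector_derivative,
        simp_all only: poly_DERIV has_field_derivative_at_within)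
  then have "integral {-1..1} (\<lambda>t. poly (pderiv f) t * poly g t + poly f t * poly (pderiv g) t)
      = poly (f * g) 1 - poly (f * g) (-1)"
    by (simp add: pderiv_mult algebra_simps integral_unique)
  then show ?thesis
    by (simp add: L2_inner_def integral_add L2_inner_integrable)
qed

lemma coeff_pcompose_reflect:
  "coeff (pcompose f [:0, -1:]) n = (-1) ^ n * coeff (f :: real poly) n"
  by (simp add: coeff_pcompose_linear)

section \<open>Orthogonality and parity\<close>

context
  fixes p :: "nat \<Rightarrow> real poly"
  assumes legendre: "monic_legendre p"
begin

lemma degree_legendre [simp]: "degree (p k) = k"
  and coeff_legendre [simp]: "coeff (p k) k = 1"
  and legendre_orthogonal: "j \<noteq> k \<Longrightarrow> L2_inner (p j) (p k) = 0"
  using legendre by (auto simp: monic_legendre_def)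

text \<open>Such an \<open>f\<close> lies in the span of the \<open>p j\<close> with
  \<open>j < n\<close>; the induction strips off the top term. Bounding coefficients rather than the
  degree lets \<open>n = 0\<close> mean \<open>f = 0\<close>.\<close>

lemma L2_inner_eq_0_if_legendre:
  assumes "\<And>j. j < n \<Longrightarrow> L2_inner (p j) g = 0" and "\<And>i. i \<ge> n \<Longrightarrow> coeff f i = 0"
  shows "L2_inner f g = 0"
  using assms
proof (induction n arbitrary: f)
  case 0
  then have "f = 0" by (auto intro: poly_eqI)
  then show ?case by (simp add: L2_inner_def)
next
  case (Suc n)
  let ?r = "f - smult (coeff f n) (p n)"
  have "L2_inner ?r g = 0"
  proof (rule Suc.IH)
    fix i assume "n \<le> i"
    then show "coeff ?r i = 0"
      using Suc.prems(2)[of i] by (cases "i = n") (auto simp: coeff_eq_0)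
  qed (use Suc.prems in auto)
  then show ?case
    using Suc.prems(1)[of n] by (simp add: L2_inner_diff_left L2_inner_smult_left)
qed

lemma L2_inner_legendre_right:
  assumes "degree f \<le> k"
  shows "L2_inner f (p k) = coeff f k * L2_inner (p k) (p k)"
proof -
  let ?r = "f - smult (coeff f k) (p k)"
  have "L2_inner ?r (p k) = 0"
  proof (rule L2_inner_eq_0_if_legendre[of k])
    fix i assume "k \<le> i"
    then show "coeff ?r i = 0"
      using assms by (cases "i = k") (auto simp: coeff_eq_0)
  qed (auto simp: legendre_orthogonal)
  then show ?thesis by (simp add: L2_inner_diff_left L2_inner_smult_left)
qed

lemma legendre_nonzero: "p k \<noteq> 0"
  using coeff_legendre[of k] by (metis coeff_0 zero_neq_one)

lemma legendre_norm_pos: "L2_inner (p k) (p k) > 0"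
  using L2_inner_nonneg[of "p k"] L2_inner_self_eq_0D[of "p k"] legendre_nonzero[of k]
  by (auto simp: less_le)

text \<open>Reflection scales the leading coefficient by \<open>(-1) ^ k\<close>, so the difference
  \<open>?g\<close> of the two sides has degree below \<open>k\<close> or is zero. It is orthogonal
  to both sides, hence to itself.\<close>

lemma pcompose_legendre_reflect: "pcompose (p k) [:0, -1:] = smult ((-1) ^ k) (p k)"
proof -
  let ?R = "\<lambda>f. pcompose f [:0, -1:] :: real poly"
  let ?g = "?R (p k) - smult ((-1) ^ k) (p k)"
  have g: "coeff ?g i = 0" if "i \<ge> k" for i
    using that by (cases "i = k") (auto simp: coeff_pcompose_reflect coeff_eq_0)
  have orth: "L2_inner f (p k) = 0" if "\<And>i. i \<ge> k \<Longrightarrow> coeff f i = 0" for f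
    using L2_inner_eq_0_if_legendre[of k "p k" f] that legendre_orthogonal by auto
  \<comment> \<open>Reflection is an involution preserving the inner product, so it can be moved
    from \<open>p k\<close> onto \<open>?g\<close>, whose coefficients from \<open>k\<close> on stay
    zero.\<close>
  have "?R (?R ?g) = ?g" by (rule poly_eqI)
    (simp only: coeff_pcompose_reflect flip: mult.assoc power_mult_distrib, simp)
  then have "L2_inner (?R (p k)) ?g = L2_inner (p k) (?R ?g)"
    using L2_inner_reflect[of "p k" "?R ?g"] by simp
  also have "\<dots> = 0"
    using orth[of "?R ?g"] g by (simp add: coeff_pcompose_reflect L2_inner_commute)
  finally have "L2_inner ?g ?g = 0"
    using orth[of ?g] g by (simp add: L2_inner_diff_left L2_inner_smult_left L2_inner_commute)
  from L2_inner_self_eq_0D[OF this] show ?thesis by simp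
qed

lemma poly_legendre_minus: "poly (p k) (- t) = (-1) ^ k * poly (p k) t"
  using arg_cong[OF pcompose_legendre_reflect[of k], of "\<lambda>f. poly f t"]
  by (simp add: poly_pcompose)

lemma legendre_0: "p 0 = 1"
proof (rule poly_eqI)
  fix i show "coeff (p 0) i = coeff 1 i"
    by (cases i) (simp_all add: coeff_eq_0)
qed

lemma legendre_1: "p 1 = [:0, 1:]"
proof -
  have deg: "degree (p 1) = 1" and lead: "coeff (p 1) 1 = 1"
    by (rule degree_legendre coeff_legendre)+
  obtain a c where c: "p 1 = [:c, a:]"
    using degree1_coeffs[OF deg] by blast
  have "a = 1" using lead unfolding c by simp
  \<comment> \<open>Oddness at 1 reads \<open>c - 1 = - (c + 1)\<close>, so
    \<open>c = 0\<close>.\<close>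
  with c poly_legendre_minus[of 1 1] show ?thesis by simp
qed

section \<open>Norms from endpoint values\<close>

lemma legendre_endpoint_norm: "(2 * real k + 1) * L2_inner (p k) (p k) = 2 * (poly (p k) 1)\<^sup>2"
proof -
  let ?X = "[:0, 1:] :: real poly"
  have deriv: "L2_inner (?X * pderiv (p k)) (p k) = real k * L2_inner (p k) (p k)"
  \<comment> \<open>For \<open>k = 0\<close> the bound from \<open>degree_mult_le\<close> would be
    1, too large for \<open>L2_inner_legendre_right\<close>.\<close>
  proof (cases k)
    case 0
    then show ?thesis by (simp add: legendre_0 L2_inner_def)
  next
    case (Suc n)
    have "degree (?X * pderiv (p k)) \<le> k" "coeff (?X * pderiv (p k)) k = real k"
      using degree_mult_le[of ?X "pderiv (p k)"] Suc
      by (auto simp: degree_pderiv coeff_pderiv)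
    then show ?thesis using L2_inner_legendre_right[of "?X * pderiv (p k)" k] by metis
  qed
  have "L2_inner (pderiv (?X * p k)) (p k) + L2_inner (?X * p k) (pderiv (p k))
      = poly (?X * p k * p k) 1 - poly (?X * p k * p k) (-1)"
    by (rule L2_inner_by_parts)
  moreover have "pderiv (?X * p k) = ?X * pderiv (p k) + p k"
    by (simp add: pderiv_mult pderiv_pCons)
  moreover have "L2_inner (?X * p k) (pderiv (p k)) = L2_inner (?X * pderiv (p k)) (p k)"
    by (simp add: L2_inner_def ac_simps)
  moreover have "poly (p k) (-1) * poly (p k) (-1) = (poly (p k) 1)\<^sup>2"
    by (simp add: poly_legendre_minus[of k 1] power2_eq_square)
  ultimately show ?thesis
    using deriv by (simp add: L2_inner_add_left algebra_simps power2_eq_square)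
qed

text \<open>In the integration by parts only the derivative of \<open>p (Suc k)\<close> reaches
  degree \<open>k\<close>; the other inner product vanishes. The product of the two polynomials is
  odd, so the boundary terms add up.\<close>

lemma legendre_endpoint_product:
  "2 * poly (p (Suc k)) 1 * poly (p k) 1 = real (Suc k) * L2_inner (p k) (p k)"
proof -
  have "coeff (pderiv (p (Suc k))) k = real (Suc k)"
    by (simp add: coeff_pderiv)
  then have 1: "L2_inner (pderiv (p (Suc k))) (p k) = real (Suc k) * L2_inner (p k) (p k)"
    by (subst L2_inner_legendre_right) (auto simp: degree_pderiv)
  have 2: "L2_inner (p (Suc k)) (pderiv (p k)) = 0"
    by (subst L2_inner_commute, subst L2_inner_legendre_right)
      (auto simp: degree_pderiv coeff_eq_0)
  show ?thesis
    using L2_inner_by_parts[of "p (Suc k)" "p k"] 1 2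
      poly_legendre_minus[of k 1] poly_legendre_minus[of "Suc k" 1]
    by simp
qed

lemma legendre_norm_ratio:
  "(4 * (real (Suc k))\<^sup>2 - 1) * L2_inner (p (Suc k)) (p (Suc k))
    = (real (Suc k))\<^sup>2 * L2_inner (p k) (p k)"
proof -
  let ?h = "\<lambda>k. L2_inner (p k) (p k)"
  have "(real (Suc k) * ?h k)\<^sup>2 = (2 * (poly (p (Suc k)) 1)\<^sup>2) * (2 * (poly (p k) 1)\<^sup>2)"
    unfolding legendre_endpoint_product[symmetric] by (simp add: power_mult_distrib)
  also have "\<dots> = ((2 * real (Suc k) + 1) * ?h (Suc k)) * ((2 * real k + 1) * ?h k)"
    by (simp only: legendre_endpoint_norm)
  \<comment> \<open>With \<open>n = Suc k\<close> the factors are \<open>2 * n + 1\<close> and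
    \<open>2 * n - 1\<close>.\<close>
  also have "\<dots> = ((4 * (real (Suc k))\<^sup>2 - 1) * ?h (Suc k)) * ?h k"
    by (simp add: power2_eq_square algebra_simps)
  finally show ?thesis
    using legendre_norm_pos[of k] by (simp add: power2_eq_square)
qed

section \<open>The recurrence, first monic and then normalized\<close>

text \<open>The leading terms cancel in \<open>?r\<close>, so it lies in the span of the
  \<open>p j\<close> with \<open>j < ?n\<close>; being orthogonal to all of these, it is
  zero.\<close>

lemma legendre_monic_recurrence:
  assumes b: "b * L2_inner (p k) (p k) = L2_inner (p (Suc k)) (p (Suc k))"
  shows "p (Suc (Suc k)) = [:0, 1:] * p (Suc k) - smult b (p k)"
proof -
  let ?X = "[:0, 1:] :: real poly" and ?n = "Suc (Suc k)"
  let ?r = "?X * p (Suc k) - smult b (p k) - p ?n"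
  \<comment> \<open>The integrand is odd: reflection multiplies the inner product by
    \<open>e * (- e) = -1\<close>. Hence no \<open>p (Suc k)\<close> term appears.\<close>
  have refl: "L2_inner (?X * p (Suc k)) (p (Suc k)) = 0"
  proof -
    define e :: real where "e = (-1) ^ Suc k"
    have e: "e * e = 1" by (simp add: e_def)
    have P: "pcompose (p (Suc k)) [:0, -1:] = smult e (p (Suc k))"
      unfolding e_def by (rule pcompose_legendre_reflect)
    have "pcompose (?X * p (Suc k)) [:0, -1:] = smult (- e) (?X * p (Suc k))"
      unfolding pcompose_mult P by (simp add: pcompose_pCons)
    then have "e * (- e * L2_inner (?X * p (Suc k)) (p (Suc k)))
        = L2_inner (?X * p (Suc k)) (p (Suc k))"
      using L2_inner_reflect[of "?X * p (Suc k)" "p (Suc k)"]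
      by (simp only: P L2_inner_smult_left L2_inner_smult_right)
    then show ?thesis by (simp add: e flip: mult.assoc)
  qed
  have deg: "degree (?X * p j) = Suc j" and co: "coeff (?X * p j) (Suc j) = 1" for j
    by (simp_all add: legendre_nonzero degree_pCons_eq)
  have orth: "L2_inner (p j) ?r = 0" if j: "j < ?n" for j
  proof -
    \<comment> \<open>Multiplication by t is self-adjoint, so the degree of \<open>?X * p j\<close>
      decides: it is below \<open>Suc k\<close> for \<open>j < k\<close>, and for
      \<open>j = k\<close> the leading coefficient 1 yields the norm.\<close>
    have X: "L2_inner (?X * p (Suc k)) (p j) = L2_inner (?X * p j) (p (Suc k))"
      by (simp add: L2_inner_def ac_simps)
    have "L2_inner (?X * p (Suc k)) (p j) = b * L2_inner (p k) (p j)"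
    proof -
      consider "j < k" | "j = k" | "j = Suc k" using j by linarith
      then show ?thesis
      proof cases
        case 1
        then have "L2_inner (?X * p j) (p (Suc k)) = 0"
          using L2_inner_legendre_right[of "?X * p j" "Suc k"] coeff_eq_0[of "?X * p j" "Suc k"]
          by (simp only: deg)
        then show ?thesis using 1 X legendre_orthogonal[of k j] by simp
      next
        case 2
        then have "L2_inner (?X * p j) (p (Suc k)) = L2_inner (p (Suc k)) (p (Suc k))"
          using L2_inner_legendre_right[of "?X * p k" "Suc k"]
          by (simp only: deg co order_refl mult_1_left)
        then show ?thesis using 2 X b by simp
      next
        case 3
        then show ?thesis using refl legendre_orthogonal[of k j] by simp
      qed
    qed
    then show ?thesis
      using legendre_orthogonal[of ?n j] j
      by (subst L2_inner_commute) (simp add: L2_inner_diff_left L2_inner_smult_left)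
  qed
  have "L2_inner ?r ?r = 0"
  proof (rule L2_inner_eq_0_if_legendre[OF orth])
    fix i assume "?n \<le> i"
    then show "coeff ?r i = 0"
      using coeff_legendre[of ?n] co[of "Suc k"]
      by (cases "i = ?n") (auto simp: coeff_eq_0 coeff_pCons split: nat.split)
  qed
  from L2_inner_self_eq_0D[OF this] show ?thesis by simp
qed

lemma legendre_norm_Suc:
  "L2_poly_norm (p k) = sqrt (4 - 1 / (real (Suc k))\<^sup>2) * L2_poly_norm (p (Suc k))"
proof -
  have "L2_inner (p k) (p k) = (4 - 1 / (real (Suc k))\<^sup>2) * L2_inner (p (Suc k)) (p (Suc k))"
    using legendre_norm_ratio[of k] by (simp add: field_simps del: of_nat_Suc)
  then show ?thesis by (simp add: L2_poly_norm_def real_sqrt_mult)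
qed

text \<open>Here \<open>s (Suc k)\<close> is the ratio of the norms of \<open>p k\<close> and
  \<open>p (Suc k)\<close>. Starting the index at \<open>Suc k\<close> avoids truncated
  subtraction.\<close>

lemma legendre_normalized_recurrence:
  fixes k :: nat and t :: real
  defines "s \<equiv> \<lambda>k. sqrt (4 - 1 / (real k)\<^sup>2)"
  shows "poly (normalized_poly (p (Suc (Suc k)))) t = s (Suc (Suc k)) *
    (t * poly (normalized_poly (p (Suc k))) t
      - 1 / s (Suc k) * poly (normalized_poly (p k)) t)"
proof -
  let ?N = "\<lambda>k. L2_poly_norm (p k)"
  have N: "?N k = s (Suc k) * ?N (Suc k)" for k
    unfolding s_def by (rule legendre_norm_Suc)
  have Npos: "?N k > 0" for k
    using legendre_norm_pos by (simp add: L2_poly_norm_def)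
  have spos: "s (Suc k) > 0" for k
    using N[of k] Npos[of k] Npos[of "Suc k"] by (simp add: zero_less_mult_iff)
  have sq: "L2_inner (p k) (p k) = (?N k)\<^sup>2" for k
    using L2_inner_nonneg by (simp add: L2_poly_norm_def)
  \<comment> \<open>This makes \<open>1 / (s (Suc k))\<^sup>2\<close> the coefficient
    \<open>b\<close> of the monic recurrence.\<close>
  have "1 / (s (Suc k))\<^sup>2 * L2_inner (p k) (p k) = L2_inner (p (Suc k)) (p (Suc k))"
    using spos[of k] by (simp add: sq N[of k] power_mult_distrib)
  from arg_cong[OF legendre_monic_recurrence[OF this], of "\<lambda>f. poly f t"]
  have rec: "poly (p (Suc (Suc k))) t
      = t * poly (p (Suc k)) t - 1 / (s (Suc k))\<^sup>2 * poly (p k) t"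
    by simp
  show ?thesis
    \<comment> \<open>All three norms are expressed through that of \<open>p (Suc (Suc k))\<close>,
      which then cancels.\<close>
    unfolding normalized_poly_def poly_smult rec N[of k] N[of "Suc k"]
    using spos[of k] spos[of "Suc k"] Npos[of "Suc (Suc k)"]
    by (simp add: field_simps power2_eq_square)
qed

text \<open>This norm and the next follow from the endpoint identity, as \<open>p 0\<close> and
  \<open>p 1\<close> both equal 1 at 1.\<close>

lemma legendre_norm_0: "L2_poly_norm (p 0) = sqrt 2"
  using legendre_endpoint_norm[of 0] by (simp add: L2_poly_norm_def legendre_0)

lemma legendre_norm_1: "L2_poly_norm (p 1) = sqrt (2 / 3)"
  using legendre_endpoint_norm[of 1] by (simp add: L2_poly_norm_def legendre_1[simplified])

end

theorem theorem2p10: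
  fixes p q :: "nat \<Rightarrow> real poly"
  assumes "monic_legendre p"
    and "\<And>k. q k = normalized_poly (p k)"
  shows "(\<forall>k\<ge>1. \<forall>t. poly (q (k + 1)) t =
            sqrt (4 - 1 / (real (k + 1))\<^sup>2) *
            (t * poly (q k) t - 1 / sqrt (4 - 1 / (real k)\<^sup>2) * poly (q (k - 1)) t))
       \<and> (\<forall>t. poly (q 0) t = 1 / L2_poly_norm (p 0))
       \<and> 1 / L2_poly_norm (p 0) = 1 / sqrt 2
       \<and> (\<forall>t. poly (q 1) t = t / L2_poly_norm (p 1) \<and>
              t / L2_poly_norm (p 1) = sqrt (3 / 2) * t)"
proof (intro conjI allI impI)
  fix k :: nat and t :: real
  assume "k \<ge> 1"
  then obtain n where k: "k = Suc n" by (cases k) auto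
  show "poly (q (k + 1)) t = sqrt (4 - 1 / (real (k + 1))\<^sup>2) *
      (t * poly (q k) t - 1 / sqrt (4 - 1 / (real k)\<^sup>2) * poly (q (k - 1)) t)"
    using legendre_normalized_recurrence[OF assms(1), of n t]
    unfolding assms(2) k by (simp only: add_Suc_right add_0_right One_nat_def diff_Suc_Suc diff_zero)
next
  fix t
  show "poly (q 0) t = 1 / L2_poly_norm (p 0)"
    by (simp add: assms(2) normalized_poly_def legendre_0[OF assms(1)])
  show "1 / L2_poly_norm (p 0) = 1 / sqrt 2"
    by (simp add: legendre_norm_0[OF assms(1)])
  show "poly (q 1) t = t / L2_poly_norm (p 1)"
    by (simp only: assms(2) normalized_poly_def legendre_1[OF assms(1)]) simp
  show "t / L2_poly_norm (p 1) = sqrt (3 / 2) * t"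
    by (simp only: legendre_norm_1[OF assms(1)]) (simp add: real_sqrt_divide)
qed

end
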